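(* Let $\Delta\subset\mathbb{H}^3$ be the ideal tetrahedron determined by positive, pairwise linearly independent light-like vectors $\mathbf{x}_1,\mathbf{x}_2,\mathbf{x}_3,\mathbf{x}_4$ of $\mathbb{R}^4$, and for each $i<j$ let $d_{ij}$ be the signed distance between the horoballs $B_i$ and $B_j$ determined by $\mathbf{x}_i$ and $\mathbf{x}_j$. Let $\tilde\lambda_{12}$ be the geodesic joining $\mathbf{x}_1$ to $\mathbf{x}_2$, and let $\tilde\lambda_{34}$ be the geodesic joining $\mathbf{x}_3$ to $\mathbf{x}_4$. Taking $x=e^{d_{12}}$, $y=e^{d_{34}}$, $a=e^{d_{13}}$, $b=e^{d_{14}}$, $c=e^{d_{23}}$, and $d=e^{d_{24}}$, the length $T_4(x,y;a,b,c,d)$ of the transversal of $\Delta$ joining $\tilde\lambda_{12}$ to $\tilde\lambda_{34}$ is given by \[ \cosh T_4(x,y;a,b,c,d)=\frac{\sqrt{ad}+\sqrt{bc}}{\sqrt{xy}}. \]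
   Context: Hyperboloid model. On $\mathbb{R}^{4}$ put $\mathbf{x}\circ\mathbf{y}=-x_1y_1+x_2y_2+x_3y_3+x_4y_4$. A nonzero vector $\mathbf{x}$ is light-like if $\mathbf{x}\circ\mathbf{x}=0$, and positive if its first entry is positive. $\mathbb{H}^3$ is the set of $\mathbf{x}$ with positive first entry and $\mathbf{x}\circ\mathbf{x}=-1$, with $\cosh d_H(\mathbf{u},\mathbf{v})=-\mathbf{u}\circ\mathbf{v}$. Ideal points of $\mathbb{H}^3$ are projective classes $[\mathbf{x}]$ of positive light-like vectors. A positive light-like $\mathbf{x}$ determines the horosphere $S=\{\mathbf{v}\in\mathbb{H}^3:\mathbf{v}\circ\mathbf{x}=-1\}$ and the horoball $B=\{\mathbf{v}\in\mathbb{H}^3:\mathbf{v}\circ\mathbf{x}\ge-1\}$, centered at the ideal point $[\mathbf{x}]$. The geodesic joining $\mathbf{x}_i$ to $\mathbf{x}_j$ is the one with ideal endpoints $[\mathbf{x}_i]$ and $[\mathbf{x}_j]$. The ideal tetrahedron determined by $\mathbf{x}_1,\dots,\mathbf{x}_4$ is the one with ideal vertices $[\mathbf{x}_1],\dots,[\mathbf{x}_4]$ (possibly degenerate, lying in a single plane). The signed distance between two horoballs with distinct centers is the distance between their bounding horospheres along the geodesic joining their centers, with a negative sign if the horoballs overlap. The transversal joining the two opposite edges $\tilde\lambda_{12}$ and $\tilde\lambda_{34}$ is the shortest geodesic arc with one endpoint on each, or, if they intersect, their point of intersection (length $0$). *)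

theory Defs
  imports "HOL-Analysis.Analysis"
begin

definition lform :: "real^4 \<Rightarrow> real^4 \<Rightarrow> real" where
  "lform x y = - (x $ 1 * y $ 1) + x $ 2 * y $ 2 + x $ 3 * y $ 3 + x $ 4 * y $ 4"

definition light_like :: "real^4 \<Rightarrow> bool" where
  "light_like x \<longleftrightarrow> x \<noteq> 0 \<and> lform x x = 0"

definition positive_vec :: "real^4 \<Rightarrow> bool" where
  "positive_vec x \<longleftrightarrow> x $ 1 > 0"

definition hyp3 :: "(real^4) set" where
  "hyp3 = {x. positive_vec x \<and> lform x x = -1}"

text \<open>On \<open>hyp3\<close> one has \<open>- lform u v \<ge> 1\<close>, so \<open>hdist u v\<close> is the nonnegative number
  whose \<open>cosh\<close> is \<open>- lform u v\<close>.\<close>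

definition hdist :: "real^4 \<Rightarrow> real^4 \<Rightarrow> real" where
  "hdist u v = arcosh (- lform u v)"

definition horosphere :: "real^4 \<Rightarrow> (real^4) set" where
  "horosphere x = {v \<in> hyp3. lform v x = -1}"

definition horoball :: "real^4 \<Rightarrow> (real^4) set" where
  "horoball x = {v \<in> hyp3. lform v x \<ge> -1}"

text \<open>Unit-speed minimizing geodesics of \<open>hyp3\<close>, parametrized by a set \<open>I\<close> of reals.\<close>

definition geodesic_on :: "real set \<Rightarrow> (real \<Rightarrow> real^4) \<Rightarrow> bool" where
  "geodesic_on I \<gamma> \<longleftrightarrow>
     (\<forall>t\<in>I. \<gamma> t \<in> hyp3) \<and> (\<forall>s\<in>I. \<forall>t\<in>I. hdist (\<gamma> s) (\<gamma> t) = \<bar>s - t\<bar>)"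

text \<open>A projective class of vectors with positive first entry is represented by its unique
  member with first entry 1. Convergence of these representatives is convergence in
  projective space, i.e. to an ideal point when the limit is light-like.\<close>

definition proj_rep :: "real^4 \<Rightarrow> real^4" where
  "proj_rep x = x /\<^sub>R x $ 1"

definition tends_to_class :: "(real \<Rightarrow> real^4) \<Rightarrow> real^4 \<Rightarrow> real filter \<Rightarrow> bool" where
  "tends_to_class \<gamma> x F \<longleftrightarrow> ((\<lambda>t. proj_rep (\<gamma> t)) \<longlongrightarrow> proj_rep x) F"

text \<open>The complete geodesic, as a set of points, with ideal endpoints \<open>[x]\<close> and \<open>[y]\<close>.\<close>

definition geodesic_joining :: "real^4 \<Rightarrow> real^4 \<Rightarrow> (real^4) set" where
  "geodesic_joining x y =
     (THE G. \<exists>\<gamma>. geodesic_on UNIV \<gamma> \<and> tends_to_class \<gamma> x at_bot \<and> tends_to_class \<gamma> y at_top \<and>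
        G = range \<gamma>)"

text \<open>The geodesic joining the centers meets each of the two horospheres in exactly one point.\<close>

definition horosphere_gap :: "real^4 \<Rightarrow> real^4 \<Rightarrow> real" where
  "horosphere_gap x y =
     (THE r. \<exists>p \<in> horosphere x \<inter> geodesic_joining x y.
             \<exists>q \<in> horosphere y \<inter> geodesic_joining x y. r = hdist p q)"

text \<open>Horoballs that are merely tangent count as overlapping here; their gap is 0, so the
  sign is immaterial.\<close>

definition signed_dist :: "real^4 \<Rightarrow> real^4 \<Rightarrow> real" where
  "signed_dist x y =
     (if horoball x \<inter> horoball y \<noteq> {} then - horosphere_gap x y else horosphere_gap x y)"

text \<open>\<open>connecting_arc G H L \<gamma>\<close>: \<open>\<gamma>\<close> is a geodesic arc of length \<open>L\<close> with one endpoint on each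
  of \<open>G\<close> and \<open>H\<close>. The case \<open>L = 0\<close> is a one-point arc, lying on both, so that a transversal
  of two intersecting geodesics is their point of intersection.\<close>

definition connecting_arc ::
    "(real^4) set \<Rightarrow> (real^4) set \<Rightarrow> real \<Rightarrow> (real \<Rightarrow> real^4) \<Rightarrow> bool" where
  "connecting_arc G H L \<gamma> \<longleftrightarrow> 0 \<le> L \<and> geodesic_on {0..L} \<gamma> \<and> \<gamma> 0 \<in> G \<and> \<gamma> L \<in> H"

definition is_transversal ::
    "(real^4) set \<Rightarrow> (real^4) set \<Rightarrow> real \<Rightarrow> (real \<Rightarrow> real^4) \<Rightarrow> bool" where
  "is_transversal G H L \<gamma> \<longleftrightarrow>
     connecting_arc G H L \<gamma> \<and> (\<forall>L' \<gamma>'. connecting_arc G H L' \<gamma>' \<longrightarrow> L \<le> L')"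

definition transversal_length :: "(real^4) set \<Rightarrow> (real^4) set \<Rightarrow> real" where
  "transversal_length G H = (THE L. \<exists>\<gamma>. is_transversal G H L \<gamma>)"

end

theory Submission
  imports Defs
begin

text \<open>Write \<open>n\<^sub>i\<^sub>j = - lform (X i) (X j)\<close>. The geodesic joining \<open>x\<close> to \<open>y\<close> is
  \<open>t \<mapsto> (e\<^sup>-\<^sup>t x + e\<^sup>t y) / sqrt (2 n)\<close> with \<open>n = - lform x y\<close>; it meets the two horospheres at
  \<open>e\<^sup>t = sqrt (2 / n)\<close> and \<open>e\<^sup>-\<^sup>t = sqrt (2 / n)\<close>, so the signed distance of the horoballs is
  \<open>ln (n / 2)\<close>. For points at parameters \<open>s\<close>, \<open>t\<close> on the two opposite edges,
  \<open>cosh\<close> of their distance is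
  \<open>(e\<^sup>-\<^sup>s\<^sup>-\<^sup>t n\<^sub>1\<^sub>3 + e\<^sup>s\<^sup>+\<^sup>t n\<^sub>2\<^sub>4 + e\<^sup>t\<^sup>-\<^sup>s n\<^sub>1\<^sub>4 + e\<^sup>s\<^sup>-\<^sup>t n\<^sub>2\<^sub>3) / (2 sqrt (n\<^sub>1\<^sub>2 n\<^sub>3\<^sub>4))\<close>.
  The arithmetic-geometric mean inequality bounds the first two and the last two terms from
  below, and both bounds are attained simultaneously because \<open>s + t\<close> and \<open>s - t\<close> are
  independent parameters.\<close>

section \<open>The Lorentzian form\<close>

lemma lform_commute: "lform x y = lform y x"
  by (simp add: lform_def mult.commute)

lemma lform_simps [simp]:
  "lform (x + y) z = lform x z + lform y z"
  "lform z (x + y) = lform z x + lform z y"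
  "lform (x - y) z = lform x z - lform y z"
  "lform z (x - y) = lform z x - lform z y"
  "lform (r *\<^sub>R x) z = r * lform x z"
  "lform z (r *\<^sub>R x) = r * lform z x"
  "lform 0 z = 0" "lform z 0 = 0"
  by (simp_all add: lform_def algebra_simps)

text \<open>On vectors with vanishing first entry the form is the Euclidean inner product, hence
  positive definite. The sign facts below rest on this.\<close>

lemma lform_first_zero:
  assumes "x $ 1 = 0"
  shows "lform x x \<ge> 0" and "lform x x = 0 \<Longrightarrow> x = 0"
proof -
  have e: "lform x x = (x $ 2)\<^sup>2 + (x $ 3)\<^sup>2 + (x $ 4)\<^sup>2"
    using assms by (simp add: lform_def power2_eq_square)
  show "lform x x \<ge> 0" by (simp add: e)
  assume "lform x x = 0"
  then have s: "(x $ 2)\<^sup>2 + (x $ 3)\<^sup>2 + (x $ 4)\<^sup>2 = 0" using e by simp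
  have "(x $ 2)\<^sup>2 = 0" "(x $ 3)\<^sup>2 = 0" "(x $ 4)\<^sup>2 = 0"
    using s zero_le_power2[of "x $ 2"] zero_le_power2[of "x $ 3"] zero_le_power2[of "x $ 4"]
    by linarith+
  then show "x = 0" using assms by (simp add: vec_eq_iff forall_4)
qed

text \<open>The vector \<open>y $ 1 *\<^sub>R x - x $ 1 *\<^sub>R y\<close> has first entry 0; evaluating the form on it
  replaces the Cauchy-Schwarz inequality.\<close>

lemma lform_eliminate_first:
  defines "u \<equiv> \<lambda>x y :: real^4. y $ 1 *\<^sub>R x - x $ 1 *\<^sub>R y"
  shows "(y $ 1)\<^sup>2 * lform x x + (x $ 1)\<^sup>2 * lform y y \<ge> 2 * (x $ 1) * (y $ 1) * lform x y"
    and "(y $ 1)\<^sup>2 * lform x x + (x $ 1)\<^sup>2 * lform y y = 2 * (x $ 1) * (y $ 1) * lform x y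
         \<Longrightarrow> y $ 1 *\<^sub>R x = x $ 1 *\<^sub>R y"
proof -
  have e: "lform (u x y) (u x y) = (y $ 1)\<^sup>2 * lform x x + (x $ 1)\<^sup>2 * lform y y
      - 2 * (x $ 1) * (y $ 1) * lform x y"
    by (simp add: u_def lform_commute[of y x] power2_eq_square algebra_simps)
  have z: "u x y $ 1 = 0" by (simp add: u_def)
  show "(y $ 1)\<^sup>2 * lform x x + (x $ 1)\<^sup>2 * lform y y \<ge> 2 * (x $ 1) * (y $ 1) * lform x y"
    using lform_first_zero(1)[OF z] e by simp
  assume "(y $ 1)\<^sup>2 * lform x x + (x $ 1)\<^sup>2 * lform y y = 2 * (x $ 1) * (y $ 1) * lform x y"
  then have "u x y = 0" using lform_first_zero(2)[OF z] e by simp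
  then show "y $ 1 *\<^sub>R x = x $ 1 *\<^sub>R y" by (simp add: u_def)
qed

text \<open>Signature (3,1): orthogonality removes the cross term of
  \<open>lform_eliminate_first\<close>, which leaves \<open>lform w w\<close> against a nonpositive
  summand. The second part is the means of showing that a difference of two vectors
  vanishes.\<close>

lemma lform_orthogonal_timelike:
  assumes "lform z z < 0" and "lform w z = 0"
  shows "lform w w \<ge> 0" and "lform w w = 0 \<Longrightarrow> w = 0"
proof -
  have z1: "z $ 1 \<noteq> 0" using lform_first_zero(1)[of z] assms(1) by force
  have le: "(z $ 1)\<^sup>2 * lform w w + (w $ 1)\<^sup>2 * lform z z \<ge> 0"
    using lform_eliminate_first(1)[where x = w and y = z] assms(2) by simp
  have neg: "(w $ 1)\<^sup>2 * lform z z \<le> 0"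
    using assms(1) by (simp add: mult_nonneg_nonpos)
  then have "(z $ 1)\<^sup>2 * lform w w \<ge> 0" using le by linarith
  then show "lform w w \<ge> 0" using z1 by (simp add: zero_le_mult_iff)
  assume w: "lform w w = 0"
  then have "(w $ 1)\<^sup>2 * lform z z = 0" using le neg by simp
  then have "w $ 1 = 0" using assms(1) by simp
  then show "w = 0" using lform_first_zero(2) w by blast
qed

text \<open>For null vectors only the cross term of \<open>lform_eliminate_first\<close> survives,
  and its equality case would make them proportional. For equal vectors \<open>{x, y}\<close> is a
  singleton, whose independence says only that \<open>x\<close> is nonzero; hence the separate
  \<open>x \<noteq> y\<close>.\<close>

lemma lform_lightlike_neg:
  assumes "positive_vec x" "positive_vec y" "light_like x" "light_like y"
    and "x \<noteq> y" "independent {x, y}"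
  shows "lform x y < 0"
proof -
  have pos: "x $ 1 > 0" "y $ 1 > 0" and zero: "lform x x = 0" "lform y y = 0"
    using assms by (auto simp: positive_vec_def light_like_def)
  have "2 * (x $ 1) * (y $ 1) * lform x y \<le> 0"
    using lform_eliminate_first(1)[where x = x and y = y] zero by simp
  then have "lform x y \<le> 0" using pos by (simp add: mult_le_0_iff)
  moreover have "lform x y \<noteq> 0"
  proof
    assume "lform x y = 0"
    then have "y $ 1 *\<^sub>R x = x $ 1 *\<^sub>R y"
      using lform_eliminate_first(2)[where x = x and y = y] zero by simp
    then have "inverse (y $ 1) *\<^sub>R (y $ 1 *\<^sub>R x) = inverse (y $ 1) *\<^sub>R (x $ 1 *\<^sub>R y)" by simp
    then have "x = (x $ 1 / y $ 1) *\<^sub>R y" using pos by (simp add: field_simps)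
    then have "x \<in> span {y}" by (metis span_base span_scale singletonI)
    then show False using assms(5,6) by (simp add: independent_insert)
  qed
  ultimately show ?thesis by simp
qed

section \<open>Geodesics\<close>

text \<open>Reversed Cauchy-Schwarz inequality; it puts \<open>- lform u v\<close> in the range
  where \<open>arcosh\<close> inverts \<open>cosh\<close>.\<close>

lemma hyp3_lform_le:
  assumes "u \<in> hyp3" "v \<in> hyp3"
  shows "lform u v \<le> -1"
proof -
  have pos: "u $ 1 > 0" "v $ 1 > 0" and m: "lform u u = -1" "lform v v = -1"
    using assms by (auto simp: hyp3_def positive_vec_def)
  have "2 * (u $ 1) * (v $ 1) * lform u v \<le> - (v $ 1)\<^sup>2 - (u $ 1)\<^sup>2"
    using lform_eliminate_first(1)[where x = u and y = v] m by simp
  also have "\<dots> \<le> - (2 * (u $ 1) * (v $ 1))"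
    using sum_squares_bound[of "u $ 1" "v $ 1"] by simp
  finally have "2 * (u $ 1) * (v $ 1) * (lform u v + 1) \<le> 0"
    unfolding distrib_left mult_1_right by linarith
  then show ?thesis using pos by (simp add: mult_le_0_iff)
qed

lemma cosh_hdist:
  assumes "u \<in> hyp3" "v \<in> hyp3"
  shows "cosh (hdist u v) = - lform u v"
  using hyp3_lform_le[OF assms] by (simp add: hdist_def)

lemma hdist_nonneg:
  assumes "u \<in> hyp3" "v \<in> hyp3"
  shows "hdist u v \<ge> 0"
  using hyp3_lform_le[OF assms] by (simp add: hdist_def arcosh_nonneg_real)

lemma hdist_eq_abs:
  assumes "lform u v = - cosh (t :: real)"
  shows "hdist u v = \<bar>t\<bar>"
proof -
  have "hdist u v = arcosh (cosh \<bar>t\<bar>)" by (simp add: hdist_def assms)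
  then show ?thesis by (simp only: arcosh_cosh_real abs_ge_zero)
qed

text \<open>At distance 0 the difference \<open>u - v\<close> is null and orthogonal to the
  time-like \<open>v\<close>.\<close>

lemma hdist_eq_0_imp_eq:
  assumes "u \<in> hyp3" "v \<in> hyp3" "hdist u v = 0"
  shows "u = v"
proof -
  have m: "lform u u = -1" "lform v v = -1" using assms by (auto simp: hyp3_def)
  have uv: "lform u v = -1" using cosh_hdist[OF assms(1,2)] assms(3) by simp
  have "u - v = 0"
    by (rule lform_orthogonal_timelike(2)[of v]) (simp_all add: m uv lform_commute[of v u])
  then show ?thesis by simp
qed

section \<open>Geodesic segments and lines as combinations of two fixed vectors\<close>

lemma geodesic_on_lform:
  assumes "geodesic_on I \<gamma>" "s \<in> I" "t \<in> I"
  shows "lform (\<gamma> s) (\<gamma> t) = - cosh (s - t)"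
  using cosh_hdist[of "\<gamma> s" "\<gamma> t"] assms by (simp add: geodesic_on_def)

text \<open>Hyperbolic counterpart of spherical linear interpolation: the unit-speed curve through
  \<open>p\<close> at time 0 and \<open>q\<close> at time \<open>L\<close>, when \<open>L\<close> is
  their distance.\<close>

definition arc :: "real^4 \<Rightarrow> real^4 \<Rightarrow> real \<Rightarrow> real \<Rightarrow> real^4" where
  "arc p q L t = (sinh (L - t) / sinh L) *\<^sub>R p + (sinh t / sinh L) *\<^sub>R q"

lemma arc_ends:
  assumes "L \<noteq> 0"
  shows "arc p q L 0 = p" "arc p q L L = q"
  using assms by (simp_all add: arc_def)

text \<open>After clearing \<open>(sinh L)\<^sup>2\<close> the mixed terms in
  \<open>sinh L * cosh L\<close> cancel. The times are arbitrary reals, so the curve also extends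
  beyond its two endpoints.\<close>

lemma lform_arc:
  assumes "L \<noteq> 0" "lform p p = -1" "lform q q = -1" "lform p q = - cosh L"
  shows "lform (arc p q L s) (arc p q L t) = - cosh (s - t)"
proof -
  have sh: "sinh L \<noteq> 0" using assms(1) by simp
  have qp: "lform q p = - cosh L" using assms(4) by (simp add: lform_commute)
  have "lform (arc p q L s) (arc p q L t) * (sinh L)\<^sup>2
    = - (sinh (L - s) * sinh (L - t) + sinh s * sinh t
         + cosh L * (sinh (L - s) * sinh t + sinh s * sinh (L - t)))"
    using sh by (simp add: arc_def assms qp field_simps power2_eq_square)
  also have "\<dots> = - ((sinh L)\<^sup>2 * cosh s * cosh t + (1 - (cosh L)\<^sup>2) * sinh s * sinh t)"
    by (simp add: sinh_diff algebra_simps power2_eq_square)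
  also have "\<dots> = - cosh (s - t) * (sinh L)\<^sup>2"
    by (simp add: cosh_square_eq cosh_diff algebra_simps)
  finally have "lform (arc p q L s) (arc p q L t) * (sinh L)\<^sup>2 = - cosh (s - t) * (sinh L)\<^sup>2" .
  moreover have "(sinh L)\<^sup>2 \<noteq> 0" using sh by simp
  ultimately show ?thesis using mult_right_cancel by blast
qed

lemma geodesic_on_arc:
  assumes "p \<in> hyp3" "q \<in> hyp3" "L > 0" "hdist p q = L"
  shows "geodesic_on {0..L} (arc p q L)"
proof -
  have m: "lform p p = -1" "lform q q = -1" and pos: "p $ 1 > 0" "q $ 1 > 0"
    using assms by (auto simp: hyp3_def positive_vec_def)
  have pq: "lform p q = - cosh L" using cosh_hdist[OF assms(1,2)] assms(4) by simp
  have l: "lform (arc p q L s) (arc p q L t) = - cosh (s - t)" for s t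
    using lform_arc[OF _ m pq] assms(3) by simp
  have "arc p q L t \<in> hyp3" if "t \<in> {0..L}" for t
  proof -
    define a where "a = sinh (L - t) / sinh L"
    define b where "b = sinh t / sinh L"
    have "a \<ge> 0" "b \<ge> 0" using that assms(3) by (simp_all add: a_def b_def)
    moreover have "a > 0 \<or> b > 0"
      using that assms(3) by (cases "t = 0") (simp_all add: a_def b_def)
    ultimately have "a * p $ 1 + b * q $ 1 > 0"
      using pos by (elim disjE) (simp_all add: add_pos_nonneg add_nonneg_pos)
    then have "arc p q L t $ 1 > 0" by (simp add: arc_def a_def b_def)
    then show ?thesis using l[of t t] by (simp add: hyp3_def positive_vec_def)
  qed
  then show ?thesis using hdist_eq_abs[OF l] by (simp add: geodesic_on_def)
qed

text \<open>Rigidity: two points determine a geodesic. The difference from \<open>arc\<close> is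
  orthogonal to both base points, hence to the arc itself, hence null; being orthogonal to the
  time-like \<open>\<gamma> 0\<close>, it vanishes.\<close>

lemma geodesic_on_eq_arc:
  assumes "geodesic_on I \<gamma>" "0 \<in> I" "L \<in> I" "t \<in> I" "L \<noteq> 0"
  shows "\<gamma> t = arc (\<gamma> 0) (\<gamma> L) L t"
proof -
  note l = geodesic_on_lform[OF assms(1)]
  let ?\<alpha> = "arc (\<gamma> 0) (\<gamma> L) L"
  have l\<alpha>: "lform (?\<alpha> s) (?\<alpha> r) = - cosh (s - r)" for s r
    using lform_arc[OF assms(5), of "\<gamma> 0" "\<gamma> L"] l assms(2,3) by simp
  let ?D = "\<gamma> t - ?\<alpha> t"
  have D0: "lform ?D (\<gamma> 0) = 0"
    using l\<alpha>[of t 0] l[OF assms(4,2)] by (simp add: arc_ends[OF assms(5)])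
  have DL: "lform ?D (\<gamma> L) = 0"
    using l\<alpha>[of t L] l[OF assms(4,3)] by (simp add: arc_ends[OF assms(5)])
  \<comment> \<open>The rule that splits differences in the first argument is withheld so that
    \<open>?D\<close> stays whole and \<open>D0\<close>, \<open>DL\<close> apply.\<close>
  have "lform ?D (?\<alpha> t) = 0"
    using D0 DL by (subst arc_def) (simp del: lform_simps(3))
  moreover have "lform ?D ?D = lform (\<gamma> t) (\<gamma> t) - lform (?\<alpha> t) (?\<alpha> t) - 2 * lform ?D (?\<alpha> t)"
    by (simp add: lform_commute[of "?\<alpha> t" "\<gamma> t"])
  ultimately have "lform ?D ?D = 0" using l[OF assms(4,4)] l\<alpha>[of t t] by simp
  moreover have "lform (\<gamma> 0) (\<gamma> 0) < 0" using l[OF assms(2,2)] by simp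
  ultimately have "?D = 0" using lform_orthogonal_timelike(2) D0 by blast
  then show ?thesis by simp
qed

text \<open>Every complete geodesic is spanned by two null vectors, which will be its ideal
  endpoints up to scaling.\<close>

lemma geodesic_on_exp_form:
  assumes "geodesic_on UNIV \<gamma>"
  obtains P Q where "\<And>t. \<gamma> t = exp (-t) *\<^sub>R Q + exp t *\<^sub>R P"
    and "lform P P = 0" "lform Q Q = 0" "lform Q P = -1/2"
proof -
  define p where "p = \<gamma> 0"
  define q where "q = \<gamma> 1"
  define S where "S = 2 * sinh (1::real)"
  have S: "S \<noteq> 0" by (simp add: S_def)
  \<comment> \<open>\<open>P\<close> and \<open>Q\<close> are the coefficients of
    \<open>exp t\<close> and \<open>exp (-t)\<close> when the weights of \<open>arc p q 1 t\<close>
    are written with exponentials.\<close>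
  define P where "P = (1/S) *\<^sub>R (q - exp (-1) *\<^sub>R p)"
  define Q where "Q = (1/S) *\<^sub>R (exp 1 *\<^sub>R p - q)"
  have m: "lform p p = -1" "lform q q = -1" "lform p q = - cosh 1" "lform q p = - cosh 1"
    using geodesic_on_lform[OF assms] by (simp_all add: p_def q_def)
  have ee: "exp 1 * exp (-1) = (1::real)" by (simp add: exp_minus)
  have c: "2 * cosh (1::real) = exp 1 + exp (-1)" by (simp add: cosh_field_def)
  have s: "S = exp 1 - exp (-1)" by (simp add: S_def sinh_field_def)
  have PP: "lform P P = 0"
  proof -
    have "lform P P * S\<^sup>2 = -1 + 2 * cosh 1 * exp (-1) - exp (-1) * exp (-1)"
      using S by (simp add: P_def m field_simps power2_eq_square)
    also have "\<dots> = 0" unfolding c using ee by (simp add: algebra_simps)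
    finally show ?thesis using S by simp
  qed
  have QQ: "lform Q Q = 0"
  proof -
    have "lform Q Q * S\<^sup>2 = -1 + 2 * cosh 1 * exp 1 - exp 1 * exp 1"
      using S by (simp add: Q_def m field_simps power2_eq_square)
    also have "\<dots> = 0" unfolding c using ee by (simp add: algebra_simps)
    finally show ?thesis using S by simp
  qed
  have QP: "lform Q P = -1/2"
  proof -
    have "lform Q P * S\<^sup>2 = 1 - cosh 1 * (exp 1 + exp (-1)) + exp 1 * exp (-1)"
      using S by (simp add: Q_def P_def m field_simps power2_eq_square)
    then have "2 * (lform Q P * S\<^sup>2) = 4 - (2 * cosh 1) * (exp 1 + exp (-1))"
      using ee by simp
    also have "\<dots> = - S\<^sup>2"
      unfolding c s using ee by (simp add: algebra_simps power2_eq_square)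
    finally have "(2 * lform Q P + 1) * S\<^sup>2 = 0" by (simp add: algebra_simps)
    then show ?thesis using S by simp
  qed
  have "\<gamma> t = exp (-t) *\<^sub>R Q + exp t *\<^sub>R P" for t
  proof -
    have "\<gamma> t = arc p q 1 t"
      using geodesic_on_eq_arc[OF assms, of 1 t] by (simp add: p_def q_def)
    also have "\<dots> = exp (-t) *\<^sub>R Q + exp t *\<^sub>R P"
    proof -
      have sinh_1: "sinh 1 = S / 2" by (simp add: S_def)
      have "sinh (1 - t) = (exp (-t) * exp 1 - exp t * exp (-1)) / 2"
        by (simp add: sinh_field_def flip: exp_add)
      then have 1: "sinh (1 - t) / sinh 1 = exp (-t) * exp 1 / S - exp t * exp (-1) / S"
        unfolding sinh_1 by (simp add: diff_divide_distrib)
      have "sinh t = (exp t - exp (-t)) / 2" by (simp add: sinh_field_def)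
      then have 2: "sinh t / sinh 1 = exp t / S - exp (-t) / S"
        unfolding sinh_1 by (simp add: diff_divide_distrib)
      show ?thesis unfolding arc_def 1 2 P_def Q_def by (simp add: algebra_simps)
    qed
    finally show ?thesis .
  qed
  then show ?thesis using that PP QQ QP by blast
qed

section \<open>Ideal endpoints and the complete geodesic joining two of them\<close>

lemma proj_rep_scaleR: "r \<noteq> 0 \<Longrightarrow> proj_rep (r *\<^sub>R x) = proj_rep x"
  by (simp add: proj_rep_def)

text \<open>Dividing by \<open>exp t\<close> leaves the projective class unchanged and makes the
  \<open>Q\<close> term vanish in the limit. The first entry of \<open>P\<close> must be nonzero for
  normalization to be continuous there.\<close>

lemma tends_to_class_exp:
  assumes "P $ 1 \<noteq> 0"
  shows "tends_to_class (\<lambda>t. exp (-t) *\<^sub>R Q + exp t *\<^sub>R P) P at_top"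
proof -
  have e: "proj_rep (exp (-t) *\<^sub>R Q + exp t *\<^sub>R P) = proj_rep (exp (-2 * t) *\<^sub>R Q + P)" for t
  proof -
    have "exp (-t) *\<^sub>R Q + exp t *\<^sub>R P = exp t *\<^sub>R (exp (-2 * t) *\<^sub>R Q + P)"
      by (simp add: algebra_simps flip: exp_add)
    then show ?thesis by (simp add: proj_rep_scaleR)
  qed
  have "filterlim (\<lambda>t::real. -2 * t) at_bot at_top"
    by (rule filterlim_tendsto_neg_mult_at_bot[OF tendsto_const _ filterlim_ident]) simp
  then have "((\<lambda>t::real. exp (-2 * t)) \<longlongrightarrow> 0) at_top"
    by (rule filterlim_compose[OF exp_at_bot])
  then have lim: "((\<lambda>t. exp (-2 * t) *\<^sub>R Q + P) \<longlongrightarrow> 0 *\<^sub>R Q + P) at_top"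
    by (intro tendsto_intros)
  have "((\<lambda>t. proj_rep (exp (-2 * t) *\<^sub>R Q + P)) \<longlongrightarrow> proj_rep (0 *\<^sub>R Q + P)) at_top"
    unfolding proj_rep_def
    by (intro tendsto_scaleR tendsto_inverse tendsto_vec_nth lim) (use assms in simp)
  then show ?thesis by (simp add: tends_to_class_def e)
qed

lemma tends_to_class_exp_at_bot:
  assumes "Q $ 1 \<noteq> 0"
  shows "tends_to_class (\<lambda>t. exp (-t) *\<^sub>R Q + exp t *\<^sub>R P) Q at_bot"
  using tends_to_class_exp[OF assms, of P]
  by (simp add: tends_to_class_def filterlim_at_bot_mirror add.commute)

lemma tends_to_class_proportional:
  assumes "tends_to_class \<gamma> x F" "tends_to_class \<gamma> y F" "F \<noteq> bot" "x $ 1 \<noteq> 0"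
  obtains r where "x = r *\<^sub>R y"
proof -
  have "proj_rep x = proj_rep y"
    using assms(1-3) tendsto_unique unfolding tends_to_class_def by blast
  then have "x $ 1 *\<^sub>R proj_rep x = x $ 1 *\<^sub>R proj_rep y" by simp
  then have "x = (x $ 1 / y $ 1) *\<^sub>R y"
    using assms(4) by (simp add: proj_rep_def divide_inverse)
  then show ?thesis using that by blast
qed

text \<open>For null \<open>x\<close> and \<open>y\<close> the unscaled combination has square
  \<open>2 * lform x y\<close>; the root normalizes it to -1. Parameter 0 is midway between the
  crossings of the two horospheres.\<close>

definition joining_curve :: "real^4 \<Rightarrow> real^4 \<Rightarrow> real \<Rightarrow> real^4" where
  "joining_curve x y t = (exp (-t) / sqrt (- 2 * lform x y)) *\<^sub>R x
                         + (exp t / sqrt (- 2 * lform x y)) *\<^sub>R y"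

lemma joining_curve_eq:
  "joining_curve x y t = exp (-t) *\<^sub>R ((1 / sqrt (- 2 * lform x y)) *\<^sub>R x)
                         + exp t *\<^sub>R ((1 / sqrt (- 2 * lform x y)) *\<^sub>R y)"
  by (simp add: joining_curve_def)

lemma tends_to_class_scaleR:
  "r \<noteq> 0 \<Longrightarrow> tends_to_class \<gamma> (r *\<^sub>R x) F \<longleftrightarrow> tends_to_class \<gamma> x F"
  by (simp add: tends_to_class_def proj_rep_scaleR)

context
  fixes x y :: "real^4"
  assumes pos: "positive_vec x" "positive_vec y"
    and light: "lform x x = 0" "lform y y = 0"
    and neg: "lform x y < 0"
begin

lemma lform_joining_curve_self:
  "lform (joining_curve x y s) (joining_curve x y t) = - cosh (s - t)"
proof -
  define k where "k = sqrt (- 2 * lform x y)"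
  have k: "k > 0" "k * k = - 2 * lform x y" using neg by (simp_all add: k_def)
  have "lform (joining_curve x y s) (joining_curve x y t) * (k * k)
      = (exp (-s) * exp t + exp s * exp (-t)) * lform x y"
    unfolding joining_curve_def k_def[symmetric]
    using k(1) by (simp add: light lform_commute[of y x] field_simps)
  also have "\<dots> = (2 * cosh (s - t)) * lform x y"
    by (simp add: cosh_field_def mult.commute flip: exp_add)
  also have "\<dots> = - cosh (s - t) * (k * k)" using k(2) by simp
  finally show ?thesis using k(1) by (metis mult_right_cancel less_irrefl mult_pos_pos)
qed

lemma joining_curve_hyp3: "joining_curve x y t \<in> hyp3"
proof -
  have "joining_curve x y t $ 1 > 0"
    using pos neg by (simp add: joining_curve_def positive_vec_def add_pos_pos)
  then show ?thesis
    using lform_joining_curve_self[of t t] by (simp add: hyp3_def positive_vec_def)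
qed

lemma hdist_joining_curve: "hdist (joining_curve x y s) (joining_curve x y t) = \<bar>s - t\<bar>"
  by (rule hdist_eq_abs) (rule lform_joining_curve_self)

lemma geodesic_on_joining_curve: "geodesic_on UNIV (joining_curve x y)"
  by (simp add: geodesic_on_def joining_curve_hyp3 hdist_joining_curve)

lemma tends_to_class_joining_curve:
  "tends_to_class (joining_curve x y) x at_bot" "tends_to_class (joining_curve x y) y at_top"
proof -
  define k where "k = 1 / sqrt (- 2 * lform x y)"
  have k: "k \<noteq> 0" using neg by (simp add: k_def)
  have e: "joining_curve x y = (\<lambda>t. exp (-t) *\<^sub>R (k *\<^sub>R x) + exp t *\<^sub>R (k *\<^sub>R y))"
    unfolding k_def by (rule ext) (rule joining_curve_eq)
  have nz: "(k *\<^sub>R x) $ 1 \<noteq> 0" "(k *\<^sub>R y) $ 1 \<noteq> 0" using pos k by (auto simp: positive_vec_def)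
  show "tends_to_class (joining_curve x y) x at_bot"
    using tends_to_class_exp_at_bot[OF nz(1), of "k *\<^sub>R y"] tends_to_class_scaleR[OF k] e by simp
  show "tends_to_class (joining_curve x y) y at_top"
    using tends_to_class_exp[OF nz(2), of "k *\<^sub>R x"] tends_to_class_scaleR[OF k] e by simp
qed

text \<open>The ideal endpoints fix the two null vectors of \<open>\<gamma>\<close> up to factors
  \<open>\<alpha>\<close> and \<open>\<beta>\<close>, and unit speed fixes the product of these. The
  remaining freedom is a time shift, which does not change the range.\<close>

lemma geodesic_range_unique:
  assumes "geodesic_on UNIV \<gamma>" "tends_to_class \<gamma> x at_bot" "tends_to_class \<gamma> y at_top"
  shows "range \<gamma> = range (joining_curve x y)"
proof -
  obtain P Q where \<gamma>: "\<And>t. \<gamma> t = exp (-t) *\<^sub>R Q + exp t *\<^sub>R P"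
    and PQ: "lform P P = 0" "lform Q Q = 0" "lform Q P = -1/2"
    using geodesic_on_exp_form[OF assms(1)] by blast
  have \<gamma>': "\<gamma> = (\<lambda>t. exp (-t) *\<^sub>R Q + exp t *\<^sub>R P)" using \<gamma> by blast
  have nz: "P $ 1 \<noteq> 0" "Q $ 1 \<noteq> 0"
    using lform_first_zero(2)[of P] lform_first_zero(2)[of Q] PQ by auto
  obtain \<alpha> where \<alpha>: "P = \<alpha> *\<^sub>R y"
    using tends_to_class_proportional[OF _ assms(3) _ nz(1)] tends_to_class_exp[OF nz(1), of Q]
    unfolding \<gamma>' by (metis trivial_limit_at_top_linorder)
  obtain \<beta> where \<beta>: "Q = \<beta> *\<^sub>R x"
    using tends_to_class_proportional[OF _ assms(2) _ nz(2)]
      tends_to_class_exp_at_bot[OF nz(2), of P]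
    unfolding \<gamma>' by (metis trivial_limit_at_bot_linorder)
  define k where "k = sqrt (- 2 * lform x y)"
  have k: "k > 0" "k * k = - 2 * lform x y" using neg by (simp_all add: k_def)
  have ab: "(\<alpha> * k) * (\<beta> * k) = 1"
  proof -
    have "\<beta> * (\<alpha> * lform x y) = -1/2" using PQ(3) by (simp add: \<alpha> \<beta> mult.left_commute)
    moreover have "(\<alpha> * k) * (\<beta> * k) = \<alpha> * \<beta> * (k * k)" by simp
    then have "(\<alpha> * k) * (\<beta> * k) = - 2 * (\<beta> * (\<alpha> * lform x y))"
      unfolding k(2) by (simp add: mult.left_commute)
    ultimately show ?thesis by simp
  qed
  \<comment> \<open>The factors have equal sign since their product is positive; positivity of the
    first entry excludes that both are negative.\<close>
  have "\<gamma> 0 $ 1 > 0" using assms(1) by (auto simp: geodesic_on_def hyp3_def positive_vec_def)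
  then have "\<beta> * x $ 1 + \<alpha> * y $ 1 > 0" by (simp add: \<gamma> \<alpha> \<beta>)
  moreover have "x $ 1 > 0" "y $ 1 > 0" using pos by (auto simp: positive_vec_def)
  ultimately have "\<beta> > 0 \<or> \<alpha> > 0"
    by (smt (verit) mult_nonneg_nonneg mult_minus_left)
  moreover have "\<alpha> * k > 0 \<longleftrightarrow> \<beta> * k > 0"
    using ab zero_less_mult_pos zero_less_mult_pos2 by (metis zero_less_one)
  ultimately have ap: "\<alpha> * k > 0" using k(1) by (auto simp: zero_less_mult_iff)
  define s where "s = ln (\<alpha> * k)"
  have es: "exp s = \<alpha> * k" using ap by (simp add: s_def)
  have es': "exp (-s) = \<beta> * k" using inverse_unique[OF ab] by (simp add: exp_minus es)
  have a: "\<alpha> = exp s / k" "\<beta> = exp (-s) / k" using es es' k(1) by simp_all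
  have sh: "\<gamma> t = joining_curve x y (t + s)" for t
  proof -
    have "exp (-(t + s)) = exp (-t) * exp (-s)" by (simp flip: exp_add)
    then show ?thesis
      unfolding joining_curve_def k_def[symmetric] by (simp add: \<gamma> \<alpha> \<beta> a exp_add)
  qed
  have "joining_curve x y t = \<gamma> (t - s)" for t by (simp add: sh)
  then show ?thesis using sh by (metis (no_types, lifting) rangeE rangeI subsetI subset_antisym)
qed

lemma geodesic_joining_eq: "geodesic_joining x y = range (joining_curve x y)"
  unfolding geodesic_joining_def
proof (rule the_equality)
  show "\<exists>\<gamma>. geodesic_on UNIV \<gamma> \<and> tends_to_class \<gamma> x at_bot \<and> tends_to_class \<gamma> y at_top \<and>
      range (joining_curve x y) = range \<gamma>"
    using geodesic_on_joining_curve tends_to_class_joining_curve by blast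
qed (use geodesic_range_unique in blast)

section \<open>The signed distance of horoballs\<close>

lemma lform_joining_curve_left: "lform (joining_curve x y t) x = - exp t * sqrt (- lform x y / 2)"
  and lform_joining_curve_right: "lform (joining_curve x y t) y = - exp (-t) * sqrt (- lform x y / 2)"
proof -
  define h where "h = sqrt (- lform x y / 2)"
  have h: "h > 0" "lform x y = - 2 * (h * h)" using neg by (simp_all add: h_def)
  have k: "sqrt (- 2 * lform x y) = 2 * h"
    using h by (intro real_sqrt_unique) (simp_all add: power2_eq_square)
  show "lform (joining_curve x y t) x = - exp t * sqrt (- lform x y / 2)"
    unfolding joining_curve_def k h_def[symmetric]
    using h by (simp add: light lform_commute[of y x])
  show "lform (joining_curve x y t) y = - exp (-t) * sqrt (- lform x y / 2)"
    unfolding joining_curve_def k h_def[symmetric]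
    using h by (simp add: light)
qed

text \<open>Injectivity of \<open>exp\<close> makes each crossing unique, at parameters
  \<open>- ln h\<close> and \<open>ln h\<close>. Their order depends on whether \<open>h\<close>
  exceeds 1, hence the absolute value.\<close>

lemma horosphere_gap_eq: "horosphere_gap x y = \<bar>ln (- lform x y / 2)\<bar>"
proof -
  define h where "h = sqrt (- lform x y / 2)"
  have h: "h > 0" using neg by (simp add: h_def)
  have lnh: "ln (- lform x y / 2) = 2 * ln h" using neg by (simp add: h_def ln_sqrt)
  have lx: "lform (joining_curve x y t) x = - (exp t * h)"
    and ly: "lform (joining_curve x y t) y = - (exp (-t) * h)" for t
    by (simp_all only: lform_joining_curve_left lform_joining_curve_right h_def mult_minus_left)
  have e1: "exp t * h = 1 \<longleftrightarrow> t = - ln h" for t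
  proof -
    have "exp t * h = exp (t + ln h)" using h by (simp add: exp_add)
    then show ?thesis by (simp add: eq_neg_iff_add_eq_0)
  qed
  have e2: "exp (-t) * h = 1 \<longleftrightarrow> t = ln h" for t using e1[of "-t"] by auto
  have P: "p \<in> horosphere x \<inter> geodesic_joining x y \<longleftrightarrow> p = joining_curve x y (- ln h)" for p
    using e1 by (auto simp: geodesic_joining_eq horosphere_def joining_curve_hyp3 lx)
  have Q: "p \<in> horosphere y \<inter> geodesic_joining x y \<longleftrightarrow> p = joining_curve x y (ln h)" for p
    using e2 by (auto simp: geodesic_joining_eq horosphere_def joining_curve_hyp3 ly)
  show ?thesis
    unfolding horosphere_gap_def Bex_def P Q lnh
    by (simp add: hdist_joining_curve abs_minus_commute)
qed

text \<open>Serves to separate horoballs: far-apart centers vectors keep \<open>lform v x\<close>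
  and \<open>lform v y\<close> from both being small in size. Equality holds on the joining
  geodesic.\<close>

lemma lform_mult_ge:
  assumes "v \<in> hyp3"
  shows "2 * (lform v x * lform v y) \<ge> - lform x y"
proof -
  define n where "n = lform x y"
  have n: "n < 0" "lform y x = n" using neg by (simp_all add: n_def lform_commute)
  \<comment> \<open>\<open>w\<close> is the part of \<open>v\<close> orthogonal to the plane of
    \<open>x\<close> and \<open>y\<close>; as these are null, the coefficient of each comes from
    pairing \<open>v\<close> with the other.\<close>
  define w where "w = v - (lform v y / n) *\<^sub>R x - (lform v x / n) *\<^sub>R y"
  have wx: "lform w x = 0" and wy: "lform w y = 0"
    using n by (simp_all add: w_def light flip: n_def)
  have "lform (x + y) (x + y) < 0" using n by (simp add: light flip: n_def)
  then have "lform w w \<ge> 0"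
    by (rule lform_orthogonal_timelike(1)) (simp add: wx wy)
  also have "lform w w = lform w v"
    using wx wy by (subst (2) w_def) (simp add: lform_commute)
  also have "\<dots> = -1 - 2 * (lform v x * lform v y) / n"
    using assms by (simp add: w_def hyp3_def lform_commute[of x v] lform_commute[of y v])
  finally show ?thesis using n(1) by (simp add: field_simps flip: n_def)
qed

lemma horoballs_meet_iff: "horoball x \<inter> horoball y \<noteq> {} \<longleftrightarrow> - lform x y / 2 \<le> 1"
proof
  assume "horoball x \<inter> horoball y \<noteq> {}"
  then obtain v where v: "v \<in> hyp3" "lform v x \<ge> -1" "lform v y \<ge> -1"
    by (auto simp: horoball_def)
  show "- lform x y / 2 \<le> 1"
  proof (rule ccontr)
    assume "\<not> - lform x y / 2 \<le> 1"
    then have gt: "lform v x * lform v y > 1" using lform_mult_ge[OF v(1)] by linarith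
    \<comment> \<open>Negativity confines both pairings to the interval from -1 to 0, so their
      product is at most 1.\<close>
    have "v \<in> hyp3 \<Longrightarrow> positive_vec z \<Longrightarrow> lform z z = 0 \<Longrightarrow> lform v z < 0" for z
    proof -
      assume a: "v \<in> hyp3" "positive_vec z" "lform z z = 0"
      then have "2 * (v $ 1) * (z $ 1) * lform v z \<le> - (z $ 1)\<^sup>2"
        using lform_eliminate_first(1)[where x = v and y = z] by (simp add: hyp3_def)
      also have "\<dots> < 0" using a by (simp add: positive_vec_def)
      finally show ?thesis using a
        by (simp add: hyp3_def positive_vec_def mult_less_0_iff)
    qed
    then have "lform v x < 0" "lform v y < 0" using v(1) pos light by blast+
    then have "(- lform v x) * (- lform v y) \<le> 1"
      using v by (intro mult_le_one) auto
    then show False using gt by simp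
  qed
next
  assume "- lform x y / 2 \<le> 1"
  \<comment> \<open>At the midpoint both pairings equal \<open>- sqrt (- lform x y / 2)\<close>, so
    it lies in both horoballs.\<close>
  then have "joining_curve x y 0 \<in> horoball x \<inter> horoball y"
    by (simp add: horoball_def joining_curve_hyp3 lform_joining_curve_left lform_joining_curve_right)
  then show "horoball x \<inter> horoball y \<noteq> {}" by blast
qed

text \<open>The horoballs overlap exactly when the logarithm in the gap is nonpositive, so the sign
  convention undoes the absolute value.\<close>

lemma exp_signed_dist: "exp (signed_dist x y) = - lform x y / 2"
proof -
  have "signed_dist x y = ln (- lform x y / 2)"
    unfolding signed_dist_def horoballs_meet_iff horosphere_gap_eq
    using neg by (simp add: abs_if)
  then show ?thesis using neg by simp
qed

end

section \<open>Transversals\<close>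

text \<open>An arc is as long as the distance of its endpoints, and any two points of
  \<open>hyp3\<close> are joined by one. Minimizing over arcs thus becomes minimizing
  \<open>hdist\<close> over pairs of points.\<close>

lemma transversal_length_eq:
  assumes "G \<subseteq> hyp3" "H \<subseteq> hyp3" "p \<in> G" "q \<in> H"
    and min: "\<And>u v. u \<in> G \<Longrightarrow> v \<in> H \<Longrightarrow> hdist p q \<le> hdist u v"
  shows "transversal_length G H = hdist p q"
proof -
  let ?L = "hdist p q"
  have pq: "p \<in> hyp3" "q \<in> hyp3" using assms by auto
  have L: "?L \<ge> 0" using hdist_nonneg[OF pq] .
  have "\<exists>\<gamma>. connecting_arc G H ?L \<gamma>"
  proof (cases "?L = 0")
    \<comment> \<open>\<open>arc\<close> divides by \<open>sinh L\<close>, so length 0 needs the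
      constant curve.\<close>
    case True
    then have "p = q" using hdist_eq_0_imp_eq pq by blast
    then have "connecting_arc G H ?L (\<lambda>_. p)"
      using True assms pq by (simp add: connecting_arc_def geodesic_on_def)
    then show ?thesis by blast
  next
    case False
    then have "connecting_arc G H ?L (arc p q ?L)"
      using geodesic_on_arc[OF pq] L assms by (simp add: connecting_arc_def arc_ends)
    then show ?thesis by blast
  qed
  moreover have le: "?L \<le> L'" if "connecting_arc G H L' \<gamma>'" for L' \<gamma>'
  proof -
    have "hdist (\<gamma>' 0) (\<gamma>' L') = L'"
      using that by (auto simp: connecting_arc_def geodesic_on_def)
    then show ?thesis using min that by (metis connecting_arc_def)
  qed
  ultimately obtain \<gamma> where \<gamma>: "is_transversal G H ?L \<gamma>"
    unfolding is_transversal_def by blast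
  show ?thesis
    unfolding transversal_length_def
  proof (rule the_equality)
    show "\<exists>\<gamma>. is_transversal G H ?L \<gamma>" using \<gamma> by blast
    show "L = ?L" if "\<exists>\<gamma>. is_transversal G H L \<gamma>" for L
      using that \<gamma> le by (meson is_transversal_def order_antisym)
  qed
qed

text \<open>The product of the two summands does not depend on \<open>r\<close>; the chosen
  \<open>r\<close> makes them equal.\<close>

lemma exp_amgm:
  fixes m n r :: real
  assumes "m > 0" "n > 0"
  shows "2 * sqrt (m * n) \<le> exp (-r) * m + exp r * n"
    and "r = ln (m / n) / 2 \<Longrightarrow> exp (-r) * m + exp r * n = 2 * sqrt (m * n)"
proof -
  have "sqrt ((exp (-r) * m) * (exp r * n)) \<le> (exp (-r) * m + exp r * n) / 2"
    using assms by (intro arith_geo_mean_sqrt) auto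
  moreover have "(exp (-r) * m) * (exp r * n) = m * n" by (simp add: exp_minus)
  ultimately show "2 * sqrt (m * n) \<le> exp (-r) * m + exp r * n" by simp
  assume "r = ln (m / n) / 2"
  then have "r = ln (sqrt (m / n))" using assms by (simp add: ln_sqrt)
  then have e: "exp r = sqrt m / sqrt n" using assms by (simp add: real_sqrt_divide)
  have "exp (-r) * m = sqrt m * sqrt n" "exp r * n = sqrt m * sqrt n"
    using assms by (simp_all add: exp_minus e field_simps)
  then show "exp (-r) * m + exp r * n = 2 * sqrt (m * n)" by (simp add: real_sqrt_mult)
qed

text \<open>The four pairings are grouped by \<open>s + t\<close> and \<open>s - t\<close>, so that
  \<open>exp_amgm\<close> applies to each bracket.\<close>

lemma lform_joining_curves:
  assumes "lform x1 x2 < 0" "lform x3 x4 < 0"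
  shows "- lform (joining_curve x1 x2 s) (joining_curve x3 x4 t) =
    ((exp (-(s + t)) * (- lform x1 x3) + exp (s + t) * (- lform x2 x4))
     + (exp (-(s - t)) * (- lform x1 x4) + exp (s - t) * (- lform x2 x3)))
    / (2 * sqrt (lform x1 x2 * lform x3 x4))"
proof -
  define k where "k = sqrt (- 2 * lform x1 x2)"
  define l where "l = sqrt (- 2 * lform x3 x4)"
  have kl: "2 * sqrt (lform x1 x2 * lform x3 x4) = k * l"
  proof -
    have "k * l = sqrt (4 * (lform x1 x2 * lform x3 x4))"
      by (simp add: k_def l_def flip: real_sqrt_mult)
    then show ?thesis by (simp add: real_sqrt_mult)
  qed
  have "k > 0" "l > 0" using assms by (simp_all add: k_def l_def)
  then show ?thesis
    unfolding kl joining_curve_def k_def[symmetric] l_def[symmetric]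
    by (simp add: exp_add exp_diff exp_minus field_simps)
qed

lemma cosh_transversal_length:
  assumes pos: "positive_vec x1" "positive_vec x2" "positive_vec x3" "positive_vec x4"
    and light: "lform x1 x1 = 0" "lform x2 x2 = 0" "lform x3 x3 = 0" "lform x4 x4 = 0"
    and neg: "lform x1 x2 < 0" "lform x3 x4 < 0"
      "lform x1 x3 < 0" "lform x1 x4 < 0" "lform x2 x3 < 0" "lform x2 x4 < 0"
  shows "cosh (transversal_length (geodesic_joining x1 x2) (geodesic_joining x3 x4))
    = (sqrt (lform x1 x3 * lform x2 x4) + sqrt (lform x1 x4 * lform x2 x3))
      / sqrt (lform x1 x2 * lform x3 x4)"
proof -
  let ?f = "\<lambda>s t. - lform (joining_curve x1 x2 s) (joining_curve x3 x4 t)"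
  let ?m = "(sqrt (lform x1 x3 * lform x2 x4) + sqrt (lform x1 x4 * lform x2 x3))
      / sqrt (lform x1 x2 * lform x3 x4)"
  have K: "sqrt (lform x1 x2 * lform x3 x4) > 0" using neg by (simp add: mult_neg_neg)
  note amgm1 = exp_amgm[of "- lform x1 x3" "- lform x2 x4",
    unfolded neg_0_less_iff_less minus_mult_minus minus_divide_divide, OF neg(3,6)]
  note amgm2 = exp_amgm[of "- lform x1 x4" "- lform x2 x3",
    unfolded neg_0_less_iff_less minus_mult_minus minus_divide_divide, OF neg(4,5)]
  \<comment> \<open>\<open>\<sigma>\<close> and \<open>\<tau>\<close> minimize the two brackets;
    \<open>s\<close> and \<open>t\<close> solve \<open>s + t = \<sigma>\<close>,
    \<open>s - t = \<tau>\<close>.\<close>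
  define \<sigma> where "\<sigma> = ln (lform x1 x3 / lform x2 x4) / 2"
  define \<tau> where "\<tau> = ln (lform x1 x4 / lform x2 x3) / 2"
  define s where "s = (\<sigma> + \<tau>) / 2"
  define t where "t = (\<sigma> - \<tau>) / 2"
  have st: "s + t = \<sigma>" "s - t = \<tau>" by (simp_all add: s_def t_def field_simps)
  have m: "?m = (2 * sqrt (lform x1 x3 * lform x2 x4) + 2 * sqrt (lform x1 x4 * lform x2 x3))
      / (2 * sqrt (lform x1 x2 * lform x3 x4))"
    by (simp add: add_divide_distrib)
  have lower: "?m \<le> ?f u v" for u v
    unfolding lform_joining_curves[OF neg(1,2)] m
    using K by (intro divide_right_mono add_mono amgm1(1) amgm2(1)) simp
  have attained: "?f s t = ?m"
    unfolding lform_joining_curves[OF neg(1,2)] st m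
    by (simp only: amgm1(2)[OF \<sigma>_def] amgm2(2)[OF \<tau>_def])
  note G = geodesic_joining_eq[OF pos(1,2) light(1,2) neg(1)]
  note H = geodesic_joining_eq[OF pos(3,4) light(3,4) neg(2)]
  note Gh = joining_curve_hyp3[OF pos(1,2) light(1,2) neg(1)]
  note Hh = joining_curve_hyp3[OF pos(3,4) light(3,4) neg(2)]
  have "transversal_length (geodesic_joining x1 x2) (geodesic_joining x3 x4)
      = hdist (joining_curve x1 x2 s) (joining_curve x3 x4 t)"
  proof (rule transversal_length_eq)
    fix p q assume "p \<in> geodesic_joining x1 x2" "q \<in> geodesic_joining x3 x4"
    then obtain u v where uv: "p = joining_curve x1 x2 u" "q = joining_curve x3 x4 v"
      by (auto simp: G H)
    have "cosh (hdist (joining_curve x1 x2 s) (joining_curve x3 x4 t)) \<le> cosh (hdist p q)"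
      using lower[of u v] attained by (simp add: uv cosh_hdist Gh Hh)
    then show "hdist (joining_curve x1 x2 s) (joining_curve x3 x4 t) \<le> hdist p q"
      by (simp add: cosh_real_nonneg_le_iff hdist_nonneg uv Gh Hh)
  qed (auto simp: G H Gh Hh)
  then show ?thesis using attained by (simp add: cosh_hdist Gh Hh)
qed

theorem proposition4p8:
  fixes X :: "nat \<Rightarrow> real^4" and x y a b c d :: real
  assumes "\<And>i. i \<in> {1..4} \<Longrightarrow> positive_vec (X i) \<and> light_like (X i)"
    and "\<And>i j. i \<in> {1..4} \<Longrightarrow> j \<in> {1..4} \<Longrightarrow> i \<noteq> j \<Longrightarrow>
           X i \<noteq> X j \<and> independent {X i, X j}"
    and "x = exp (signed_dist (X 1) (X 2))"
    and "y = exp (signed_dist (X 3) (X 4))"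
    and "a = exp (signed_dist (X 1) (X 3))"
    and "b = exp (signed_dist (X 1) (X 4))"
    and "c = exp (signed_dist (X 2) (X 3))"
    and "d = exp (signed_dist (X 2) (X 4))"
  shows "cosh (transversal_length (geodesic_joining (X 1) (X 2)) (geodesic_joining (X 3) (X 4)))
         = (sqrt (a * d) + sqrt (b * c)) / sqrt (x * y)"
proof -
  have pos: "positive_vec (X i)" and light: "lform (X i) (X i) = 0" if "i \<in> {1..4}" for i
    using assms(1)[OF that] by (auto simp: light_like_def)
  have neg: "lform (X i) (X j) < 0" if "i \<in> {1..4}" "j \<in> {1..4}" "i \<noteq> j" for i j
    using lform_lightlike_neg assms(1)[OF that(1)] assms(1)[OF that(2)] assms(2)[OF that] by blast
  have e: "exp (signed_dist (X i) (X j)) = - lform (X i) (X j) / 2"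
    if "i \<in> {1..4}" "j \<in> {1..4}" "i \<noteq> j" for i j
    using exp_signed_dist pos light neg that by blast
  \<comment> \<open>Each exponential is half of a negated pairing, so every root acquires a factor
    1/2, which cancels in the quotient.\<close>
  have half: "sqrt ((- u / 2) * (- v / 2)) = sqrt (u * v) / 2" for u v :: real
    by (simp add: real_sqrt_divide)
  have "cosh (transversal_length (geodesic_joining (X 1) (X 2)) (geodesic_joining (X 3) (X 4)))
    = (sqrt (lform (X 1) (X 3) * lform (X 2) (X 4)) + sqrt (lform (X 1) (X 4) * lform (X 2) (X 3)))
      / sqrt (lform (X 1) (X 2) * lform (X 3) (X 4))"
    by (rule cosh_transversal_length) (simp_all add: pos light neg)
  moreover have "x = - lform (X 1) (X 2) / 2" "y = - lform (X 3) (X 4) / 2"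
    "a = - lform (X 1) (X 3) / 2" "b = - lform (X 1) (X 4) / 2"
    "c = - lform (X 2) (X 3) / 2" "d = - lform (X 2) (X 4) / 2"
    unfolding assms(3-8) by (simp_all add: e)
  ultimately show ?thesis by (simp only: half) (simp add: add_divide_distrib)
qed

end
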